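(* Let $\log$ denote $\log_2$ and, for a graph $G$, let $\mathrm{mis}(G)$ be the number of maximal independent sets of $G$. (a) For every $\varepsilon>0$ there is $d_0$ such that for every $d\ge d_0$ and every $d$-regular graph $G$ on $n$ vertices, $$\log \mathrm{mis}(G) < \begin{cases}(1+\varepsilon)\,\dfrac{n}{4} & \text{if } G \text{ is triangle-free},\\[2mm] (1+\varepsilon)\,\dfrac{n\log 3}{6} & \text{in general.}\end{cases}$$ (That is, $\log\mathrm{mis}(G)<(1+o(1))n/4$, resp. $(1+o(1))n\log 3/6$, with $o(1)\to 0$ as $d\to\infty$.) (b) For every $\varepsilon>0$ there is $m_0$ such that for all positive integers $r,s$ with $\max\{r,s\}\ge m_0$ and every $(r,s)$-biregular graph $G$ on $n$ vertices, $$\log \mathrm{mis}(G) < (1+\varepsilon)\,\frac{rsn}{(r+s)^2}.$$ (That is, $\log\mathrm{mis}(G)<(1+o(1))rsn/(r+s)^2$ with $o(1)\to 0$ as $\max\{r,s\}\to\infty$.)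
   Context: A graph $G$ is $(r,s)$-biregular if it is bipartite with a bipartition $V(G)=A\cup B$ such that every vertex of $A$ has degree $r$ and every vertex of $B$ has degree $s$. A graph is $d$-regular if every vertex has degree $d$. *)

theory Defs
  imports Complex_Main "Graph_Theory.Pair_Digraph"
begin

(* A finite simple graph is a pair_graph: a finite vertex set pverts G with an irreflexive
   symmetric relation parcs G on it, so an edge uv is present as both (u,v) and (v,u), and
   out_degree is the usual degree of a vertex. *)

definition independent_set :: "'a pair_pre_digraph \<Rightarrow> 'a set \<Rightarrow> bool" where
  "independent_set G I \<longleftrightarrow> I \<subseteq> pverts G \<and> (\<forall>u\<in>I. \<forall>v\<in>I. (u, v) \<notin> parcs G)"

definition maximal_independent_set :: "'a pair_pre_digraph \<Rightarrow> 'a set \<Rightarrow> bool" where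
  "maximal_independent_set G I \<longleftrightarrow>
     independent_set G I \<and> (\<forall>J. independent_set G J \<and> I \<subseteq> J \<longrightarrow> J = I)"

definition mis :: "'a pair_pre_digraph \<Rightarrow> nat" where
  "mis G = card {I. maximal_independent_set G I}"

definition triangle_free :: "'a pair_pre_digraph \<Rightarrow> bool" where
  "triangle_free G \<longleftrightarrow>
     \<not> (\<exists>u v w. (u, v) \<in> parcs G \<and> (v, w) \<in> parcs G \<and> (w, u) \<in> parcs G)"

definition regular_graph :: "nat \<Rightarrow> 'a pair_pre_digraph \<Rightarrow> bool" where
  "regular_graph d G \<longleftrightarrow> (\<forall>v\<in>pverts G. out_degree (with_proj G) v = d)"

definition bipartition :: "'a pair_pre_digraph \<Rightarrow> 'a set \<Rightarrow> 'a set \<Rightarrow> bool" where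
  "bipartition G A B \<longleftrightarrow>
     pverts G = A \<union> B \<and> A \<inter> B = {} \<and> independent_set G A \<and> independent_set G B"

definition biregular_graph :: "nat \<Rightarrow> nat \<Rightarrow> 'a pair_pre_digraph \<Rightarrow> bool" where
  "biregular_graph r s G \<longleftrightarrow> (\<exists>A B. bipartition G A B \<and>
     (\<forall>v\<in>A. out_degree (with_proj G) v = r) \<and> (\<forall>v\<in>B. out_degree (with_proj G) v = s))"

lemma out_degree_eq_card_neighbours:
  "out_degree (with_proj G) v = card {w. (v, w) \<in> parcs G}"
proof -
  have "out_arcs (with_proj G) v = Pair v ` {w. (v, w) \<in> parcs G}"
    by (auto simp: out_arcs_def)
  then show ?thesis
    by (simp add: out_degree_def card_image inj_on_def)
qed

(* So log 2 (mis G) never takes the junk value of log at 0. *)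
lemma (in pair_graph) mis_pos: "0 < mis G"
proof -
  let ?S = "{I. independent_set G I}"
  have fin: "finite ?S"
    by (rule finite_subset[of _ "Pow (pverts G)"])
       (auto simp: independent_set_def pair_finite_verts)
  have "{} \<in> ?S"
    by (simp add: independent_set_def)
  then obtain I where "I \<in> ?S" "\<And>J. J \<in> ?S \<Longrightarrow> I \<subseteq> J \<Longrightarrow> I = J"
    using finite_has_maximal[OF fin] by blast
  then have "I \<in> {I. maximal_independent_set G I}"
    by (auto simp: maximal_independent_set_def)
  moreover have "finite {I. maximal_independent_set G I}"
    by (rule finite_subset[OF _ fin]) (auto simp: maximal_independent_set_def)
  ultimately show ?thesis
    unfolding mis_def by (metis card_gt_0_iff empty_iff)
qed

end

(* Let I be a maximal independent set and T a maximal subset of I with k|T| \<le> |N(T)|. Then every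
   vertex of I has fewer than k neighbours outside N(T), so I lies in the container W consisting of
   the vertices outside N(T) with this property, and I is a maximal independent set of G[W]. There
   are only 2^(o(n)) choices of T as k grows. Counting the edges between W and N(T) shows that
   |W| \<le> (1 + o(1)) n/2 for regular G, and that min(|W \<inter> A|, |W \<inter> B|) \<le> (1 + o(1)) rsn/(r+s)^2 for
   biregular G. It remains to bound mis(G[W]) by 3^(|W|/3) (Moon-Moser), by 2^(|W|/2) without
   triangles (Hujter-Tuza), and by 2^|W \<inter> A| in the bipartite case. If r is much larger than s, the
   bound 2^|A| for G itself is already good enough. *)

theory Submission
  imports Defs
begin

section \<open>Maximal independent sets of induced subgraphs\<close>

text \<open>With the vertex set \<open>W\<close> as a parameter, all induced subgraphs share one
  edge relation \<open>E\<close>; arcs leaving \<open>W\<close> have no effect. Maximality is stated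
  as domination, which passes directly to smaller vertex sets.\<close>

definition mis_sets :: "'a rel \<Rightarrow> 'a set \<Rightarrow> 'a set set" where
  "mis_sets E W = {I. I \<subseteq> W \<and> (\<forall>u\<in>I. \<forall>v\<in>I. (u, v) \<notin> E) \<and> (\<forall>x\<in>W - I. \<exists>u\<in>I. (x, u) \<in> E)}"

lemma finite_mis_sets: "finite W \<Longrightarrow> finite (mis_sets E W)"
  by (rule finite_subset[of _ "Pow W"]) (auto simp: mis_sets_def)

lemma mis_sets_empty [simp]: "mis_sets E {} = {{}}"
  by (auto simp: mis_sets_def)

lemma mis_sets_restrict: "I \<in> mis_sets E V \<Longrightarrow> I \<subseteq> W \<Longrightarrow> W \<subseteq> V \<Longrightarrow> I \<in> mis_sets E W"
  by (auto simp: mis_sets_def)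

text \<open>A vertex with no neighbour in \<open>I\<close> could be added to \<open>I\<close>, since
  edges are symmetric and there are no loops. So maximality amounts to domination.\<close>

lemma (in pair_graph) maximal_independent_set_iff:
  "maximal_independent_set G I \<longleftrightarrow> I \<in> mis_sets (parcs G) (pverts G)"
proof
  assume m: "maximal_independent_set G I"
  then have i: "I \<subseteq> pverts G" "\<forall>u\<in>I. \<forall>v\<in>I. (u, v) \<notin> parcs G"
    by (auto simp: maximal_independent_set_def independent_set_def)
  have "\<exists>u\<in>I. (x, u) \<in> parcs G" if x: "x \<in> pverts G - I" for x
  proof (rule ccontr)
    assume n: "\<not> ?thesis"
    then have "independent_set G (insert x I)"
      using i x no_loops'[of x x] by (auto simp: independent_set_def dest: arcs_symmetric)
    then show False
      using m x by (auto simp: maximal_independent_set_def)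
  qed
  then show "I \<in> mis_sets (parcs G) (pverts G)"
    using i by (auto simp: mis_sets_def)
next
  assume "I \<in> mis_sets (parcs G) (pverts G)"
  then show "maximal_independent_set G I"
    unfolding maximal_independent_set_def independent_set_def mis_sets_def by blast
qed

lemma (in pair_graph) mis_eq: "mis G = card (mis_sets (parcs G) (pverts G))"
  by (simp add: mis_def maximal_independent_set_iff)

section \<open>Extremal bounds\<close>

text \<open>Once \<open>S\<close> is chosen, its neighbours are excluded, and any other vertex left
  out must be dominated from outside \<open>S\<close>. Hence removing \<open>S\<close> is an
  injection into the maximal independent sets of what remains.\<close>

lemma card_mis_sets_superset:
  assumes "finite W" "sym E"
  shows "card {I \<in> mis_sets E W. S \<subseteq> I} \<le> card (mis_sets E (W - (S \<union> E `` S)))"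
proof (rule card_inj_on_le[of "\<lambda>I. I - S"])
  show "inj_on (\<lambda>I. I - S) {I \<in> mis_sets E W. S \<subseteq> I}"
    by (auto simp: inj_on_def)
  show "(\<lambda>I. I - S) ` {I \<in> mis_sets E W. S \<subseteq> I} \<subseteq> mis_sets E (W - (S \<union> E `` S))"
    using assms(2) unfolding mis_sets_def sym_def by (auto simp: Image_def; blast)
  show "finite (mis_sets E (W - (S \<union> E `` S)))"
    using assms by (simp add: finite_mis_sets)
qed

text \<open>Form used for branching inside an induction on \<open>W\<close>: every set
  \<open>R\<close> of vertices decided by choosing \<open>S\<close> saves \<open>card R\<close> in
  the exponent. As \<open>R\<close> is nonempty, the remainder is a proper subset of
  \<open>W\<close> and \<open>IH\<close> applies to it.\<close>

lemma card_mis_sets_superset_powr: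
  fixes b :: real
  assumes W: "finite W" "sym E" and b: "1 \<le> b"
    and IH: "\<And>U. U \<subset> W \<Longrightarrow> real (card (mis_sets E U)) \<le> b powr real (card U)"
    and R: "R \<subseteq> W" "R \<subseteq> S \<union> E `` S" "R \<noteq> {}"
  shows "real (card {I \<in> mis_sets E W. S \<subseteq> I}) \<le> b powr (real (card W) - real (card R))"
proof -
  let ?U = "W - (S \<union> E `` S)"
  have "card ?U \<le> card (W - R)"
    using W R by (intro card_mono) auto
  then have le: "real (card ?U) \<le> real (card W) - real (card R)"
    using W R card_mono[of W R] by (simp add: card_Diff_subset finite_subset)
  have "real (card {I \<in> mis_sets E W. S \<subseteq> I}) \<le> real (card (mis_sets E ?U))"
    using card_mis_sets_superset W by simp
  also have "\<dots> \<le> b powr real (card ?U)"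
    using R by (intro IH) auto
  also have "\<dots> \<le> b powr (real (card W) - real (card R))"
    using le b by (intro powr_mono) auto
  finally show ?thesis .
qed

lemma mis_sets_meets_closed_neighbourhood:
  assumes "v \<in> W" "I \<in> mis_sets E W"
  obtains u where "u \<in> insert v (W \<inter> E `` {v})" "u \<in> I"
  using assms unfolding mis_sets_def by blast

text \<open>Every maximal independent set contains a vertex of the closed neighbourhood of
  \<open>v\<close>, which gives m + 1 branches. Since \<open>v\<close> has minimum degree, each
  branch decides at least m + 1 vertices.\<close>

lemma card_mis_sets_branch:
  fixes b :: real
  assumes W: "finite W" "sym E" "irrefl E" and b: "1 \<le> b"
    and IH: "\<And>U. U \<subset> W \<Longrightarrow> real (card (mis_sets E U)) \<le> b powr real (card U)"
    and v: "v \<in> W" and deg: "card (W \<inter> E `` {v}) = m"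
    and min: "\<And>u. u \<in> W \<Longrightarrow> m \<le> card (W \<inter> E `` {u})"
  shows "real (card (mis_sets E W)) \<le> (real m + 1) * b powr (real (card W) - (real m + 1))"
proof -
  let ?N = "\<lambda>u. insert u (W \<inter> E `` {u})"
  have cN: "card (?N u) = card (W \<inter> E `` {u}) + 1" for u
    using W by (simp add: irrefl_def)
  have "mis_sets E W \<subseteq> (\<Union>u\<in>?N v. {I \<in> mis_sets E W. {u} \<subseteq> I})"
    using mis_sets_meets_closed_neighbourhood[OF v] by blast
  then have "card (mis_sets E W) \<le> card (\<Union>u\<in>?N v. {I \<in> mis_sets E W. {u} \<subseteq> I})"
    using W by (intro card_mono finite_UN_I) (auto simp: finite_mis_sets)
  also have "\<dots> \<le> (\<Sum>u\<in>?N v. card {I \<in> mis_sets E W. {u} \<subseteq> I})"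
    using W by (intro card_UN_le) auto
  finally have "real (card (mis_sets E W)) \<le> (\<Sum>u\<in>?N v. real (card {I \<in> mis_sets E W. {u} \<subseteq> I}))"
    by (simp only: of_nat_sum[symmetric] of_nat_le_iff)
  also have "\<dots> \<le> (\<Sum>u\<in>?N v. b powr (real (card W) - (real m + 1)))"
  proof (rule sum_mono)
    fix u assume "u \<in> ?N v"
    then have u: "u \<in> W" using v by auto
    have "real (card {I \<in> mis_sets E W. {u} \<subseteq> I}) \<le> b powr (real (card W) - real (card (?N u)))"
      using u by (intro card_mis_sets_superset_powr W b IH) auto
    also have "\<dots> \<le> b powr (real (card W) - (real m + 1))"
      using min[OF u] cN[of u] b by (intro powr_mono) auto
    finally show "real (card {I \<in> mis_sets E W. {u} \<subseteq> I}) \<le> b powr (real (card W) - (real m + 1))" .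
  qed
  also have "\<dots> = (real m + 1) * b powr (real (card W) - (real m + 1))"
    using cN[of v] deg by (simp del: card_insert_disjoint)
  finally show ?thesis .
qed

lemma min_degree_vertex:
  assumes "finite W" "W \<noteq> {}"
  obtains v where "v \<in> W" "\<And>u. u \<in> W \<Longrightarrow> card (W \<inter> E `` {v}) \<le> card (W \<inter> E `` {u})"
  using arg_min_if_finite[OF assms, of "\<lambda>v. card (W \<inter> E `` {v})"]
  by (metis not_le_imp_less)

section \<open>Numerical inequalities for the branching recursions\<close>

text \<open>This is n \<le> b^n for b = 3^(1/3) in integer form; with n = degree + 1 it closes the
  Moon-Moser recursion. Equality at n = 3 determines the base.\<close>

lemma cube_le_3_power: "n ^ 3 \<le> (3::nat) ^ n"
proof -
  consider "n = 0" | "n = 1" | "n = 2" | "3 \<le> n" by linarith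
  then show ?thesis
  proof cases
    case 4
    then show ?thesis
    proof (induction n rule: dec_induct)
      case (step n)
      \<comment> \<open>After substituting n = 3 + j, the difference of the two sides is a
        polynomial in j with nonnegative coefficients.\<close>
      obtain j where "n = 3 + j" using step(1) le_Suc_ex by blast
      then have "(Suc n) ^ 3 \<le> 3 * n ^ 3"
        by (simp add: power3_eq_cube algebra_simps)
      with step.IH show ?case by simp
    qed simp
  qed simp_all
qed

text \<open>The analogue of the cubic inequality for b = 2^(1/2). It fails at n = 3, where 9 >
  8.\<close>

lemma square_le_2_power: "n \<noteq> 3 \<Longrightarrow> n ^ 2 \<le> (2::nat) ^ n"
proof -
  assume "n \<noteq> 3"
  then consider "n = 0" | "n = 1" | "n = 2" | "4 \<le> n" by linarith
  then show ?thesis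
  proof cases
    case 4
    then show ?thesis
    proof (induction n rule: dec_induct)
      case (step n)
      obtain j where "n = 4 + j" using step(1) le_Suc_ex by blast
      then have "(Suc n) ^ 2 \<le> 2 * n ^ 2"
        by (simp add: power2_eq_square algebra_simps)
      with step.IH show ?case by simp
    qed simp
  qed simp_all
qed

lemma le_powr_of_power_le:
  assumes "0 < n" "m ^ n \<le> (b::nat) ^ m" "0 < b"
  shows "real m \<le> (real b powr (1 / real n)) powr real m"
proof -
  have "(real m) ^ n \<le> ((real b powr (1 / real n)) powr real m) ^ n"
  proof -
    have "((real b powr (1 / real n)) powr real m) ^ n = real b ^ m"
      using assms by (simp add: powr_powr flip: powr_realpow) 
    then show ?thesis
      using assms(2) by (metis of_nat_le_iff of_nat_power)
  qed
  then show ?thesis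
    using assms(1) by (subst (asm) power_mono_iff) auto
qed

text \<open>Branching at a vertex of minimum degree m - 1 gives at most m b^(|W| - m) sets with b =
  3^(1/3), and m \<le> b^m.\<close>

theorem moon_moser:
  assumes "finite W" "sym E" "irrefl E"
  shows "real (card (mis_sets E W)) \<le> (3 powr (1/3)) powr real (card W)"
  using assms(1)
proof (induction W rule: finite_psubset_induct)
  case (psubset W)
  show ?case
  proof (cases "W = {}")
    case False
    then obtain v where v: "v \<in> W" "\<And>u. u \<in> W \<Longrightarrow> card (W \<inter> E `` {v}) \<le> card (W \<inter> E `` {u})"
      using min_degree_vertex psubset.hyps by metis
    define m where "m = card (W \<inter> E `` {v}) + 1"
    let ?b = "(3::real) powr (1/3)"
    have "real (card (mis_sets E W)) \<le> real m * ?b powr (real (card W) - real m)"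
      using card_mis_sets_branch[OF psubset.hyps assms(2,3) _ psubset.IH v(1) refl v(2)]
      by (simp add: m_def ge_one_powr_ge_zero add.commute)
    also have "\<dots> \<le> ?b powr real m * ?b powr (real (card W) - real m)"
      using le_powr_of_power_le[of 3 m 3] cube_le_3_power[of m] by (intro mult_right_mono) auto
    finally show ?thesis
      by (simp flip: powr_add)
  qed simp
qed

text \<open>The Moon-Moser argument with base b = 2^(1/2) works unless the minimum degree is 2.
  There, a three-way branching that saves 3, 3 and 4 vertices replaces the plain one, and 2 b^(-3) +
  b^(-4) \<le> 1.\<close>

theorem hujter_tuza:
  assumes "finite W" "sym E" "irrefl E"
    and tf: "\<And>x y z. (x, y) \<in> E \<Longrightarrow> (y, z) \<in> E \<Longrightarrow> (z, x) \<notin> E"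
  shows "real (card (mis_sets E W)) \<le> (2 powr (1/2)) powr real (card W)"
  using assms(1)
proof (induction W rule: finite_psubset_induct)
  case (psubset W)
  let ?b = "(2::real) powr (1/2)"
  have b1: "1 \<le> ?b" by (simp add: ge_one_powr_ge_zero)
  show ?case
  proof (cases "W = {}")
    case False
    then obtain v where v: "v \<in> W" "\<And>u. u \<in> W \<Longrightarrow> card (W \<inter> E `` {v}) \<le> card (W \<inter> E `` {u})"
      using min_degree_vertex psubset.hyps by metis
    \<comment> \<open>Plain branching needs m^2 \<le> 2^m for m = degree + 1, which fails only at degree 2.\<close>
    show ?thesis
    proof (cases "card (W \<inter> E `` {v}) = 2")
      case False
      define m where "m = card (W \<inter> E `` {v}) + 1"
      have "real (card (mis_sets E W)) \<le> real m * ?b powr (real (card W) - real m)"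
        using card_mis_sets_branch[OF psubset.hyps assms(2,3) b1 psubset.IH v(1) refl v(2)]
        by (simp add: m_def add.commute)
      also have "\<dots> \<le> ?b powr real m * ?b powr (real (card W) - real m)"
        using le_powr_of_power_le[of 2 m 2] square_le_2_power[of m] False
        by (intro mult_right_mono) (auto simp: m_def)
      finally show ?thesis
        by (simp flip: powr_add)
    next
      case True
      let ?f = "\<lambda>S. {I \<in> mis_sets E W. S \<subseteq> I}"
      note fin = psubset.hyps
      have deg2: "2 \<le> card (W \<inter> E `` {u})" if "u \<in> W" for u
        using v(2)[OF that] True by simp
      have closed: "card (insert u (W \<inter> E `` {u})) = card (W \<inter> E `` {u}) + 1" for u
        using fin assms(3) by (simp add: irrefl_def)
      have superset: "real (card (?f S)) \<le> ?b powr (real (card W) - real j)"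
        if "R \<subseteq> W" "R \<subseteq> S \<union> E `` S" "0 < j" "j \<le> card R" for S R j
      proof -
        have "real (card (?f S)) \<le> ?b powr (real (card W) - real (card R))"
          using that fin by (intro card_mis_sets_superset_powr assms b1 psubset.IH) auto
        also have "\<dots> \<le> ?b powr (real (card W) - real j)"
          using that b1 by (intro powr_mono) auto
        finally show ?thesis .
      qed
      have single: "real (card (?f {u})) \<le> ?b powr (real (card W) - 3)" if "u \<in> W" for u
        using superset[of "insert u (W \<inter> E `` {u})" "{u}" 3] that deg2[OF that] closed[of u] by auto
      obtain u1 u2 where N: "W \<inter> E `` {v} = {u1, u2}" "u1 \<noteq> u2"
        using True by (auto simp: card_2_iff)
      then have u: "u1 \<in> W" "u2 \<in> W" "(v, u1) \<in> E" "(v, u2) \<in> E" by auto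
      have meets: "v \<in> I \<or> u1 \<in> I \<or> u2 \<in> I" if "I \<in> mis_sets E W" for I
        using mis_sets_meets_closed_neighbourhood[OF v(1) that] N by auto
      have three: "real (card (mis_sets E W)) \<le> 
          real (card (?f P)) + real (card (?f Q)) + real (card (?f S))"
        if "mis_sets E W \<subseteq> ?f P \<union> ?f Q \<union> ?f S" for P Q S
      proof -
        have "card (mis_sets E W) \<le> card (?f P \<union> ?f Q \<union> ?f S)"
          using that fin by (intro card_mono) (auto simp: finite_mis_sets)
        also have "\<dots> \<le> card (?f P) + card (?f Q) + card (?f S)"
          by (meson add_le_mono1 card_Un_le order_trans)
        finally show ?thesis by linarith
      qed
      \<comment> \<open>Three branches, one of which saves a fourth vertex. If \<open>u1\<close> has
        degree at least 3, it provides that branch itself; if its degree is 2, choosing both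
        \<open>u2\<close> and \<open>w\<close> does.\<close>
      have "\<exists>P Q S. mis_sets E W \<subseteq> ?f P \<union> ?f Q \<union> ?f S \<and>
        real (card (?f P)) \<le> ?b powr (real (card W) - 3) \<and>
        real (card (?f Q)) \<le> ?b powr (real (card W) - 3) \<and>
        real (card (?f S)) \<le> ?b powr (real (card W) - 4)"
      proof (cases "card (W \<inter> E `` {u1}) = 2")
        case False
        have "real (card (?f {u1})) \<le> ?b powr (real (card W) - 4)"
          using superset[of "insert u1 (W \<inter> E `` {u1})" "{u1}" 4] u deg2[OF u(1)] False closed[of u1]
          by auto
        moreover have "mis_sets E W \<subseteq> ?f {v} \<union> ?f {u2} \<union> ?f {u1}"
          using meets by auto
        ultimately show ?thesis using single v(1) u by blast
      next
        case True
        have "v \<in> W \<inter> E `` {u1}" using v(1) u assms(2) by (auto dest: symD)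
        then have "card (W \<inter> E `` {u1} - {v}) = 1"
          using True fin by (subst card_Diff_singleton) auto
        then obtain w where "W \<inter> E `` {u1} - {v} = {w}" by (rule card_1_singletonE)
        with \<open>v \<in> W \<inter> E `` {u1}\<close> have w: "W \<inter> E `` {u1} = {v, w}" "w \<noteq> v" by blast+
        then have w': "w \<in> W" "(u1, w) \<in> E" by auto
        \<comment> \<open>If neither v nor u1 is chosen, v must be dominated by u2 and u1 by w.\<close>
        have "mis_sets E W \<subseteq> ?f {v} \<union> ?f {u1} \<union> ?f {u2, w}"
        proof
          fix I assume I: "I \<in> mis_sets E W"
          then have "u1 \<in> I \<or> v \<in> I \<or> w \<in> I"
            using mis_sets_meets_closed_neighbourhood[OF u(1) I] w by auto
          then show "I \<in> ?f {v} \<union> ?f {u1} \<union> ?f {u2, w}"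
            using I meets[OF I] by auto
        qed
        \<comment> \<open>If w = u2, then v, u1, u2 would form a triangle. So choosing
          \<open>u2\<close> and \<open>w\<close> decides four distinct vertices: these two,
          \<open>v\<close> as a neighbour of \<open>u2\<close>, and \<open>u1\<close> as a neighbour
          of \<open>w\<close>.\<close>
        moreover have "w \<noteq> u2"
          using tf u w' assms(2) by (metis symD)
        then have "card {v, u1, u2, w} = 4"
          using w N u w' assms(3) by (auto simp: irrefl_def card_insert_if)
        then have "real (card (?f {u2, w})) \<le> ?b powr (real (card W) - real 4)"
          using u w' v(1) assms(2)
          by (intro superset[of "{v, u1, u2, w}"]) (auto dest: symD)
        ultimately show ?thesis using single[OF v(1)] single[OF u(1)]
          by (intro exI[of _ "{v}"] exI[of _ "{u1}"] exI[of _ "{u2, w}"]) simp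
      qed
      then have "real (card (mis_sets E W)) \<le>
        2 * ?b powr (real (card W) - 3) + ?b powr (real (card W) - 4)"
        by (elim exE conjE) (drule three, linarith)
      also have "\<dots> \<le> ?b powr real (card W)"
      proof -
        have "?b powr 3 = 2 * sqrt 2" "?b powr 4 = 4"
          by (simp_all add: powr_half_sqrt powr_numeral power4_eq_xxxx power3_eq_cube)
        \<comment> \<open>The estimate sqrt 2 \<ge> 4/3 is just enough: it gives 3/4 + 1/4 =
          1.\<close>
        moreover have "2 / (2 * sqrt 2) + 1 / 4 \<le> (1::real)"
        proof -
          have "4 / 3 \<le> sqrt 2" by (rule real_le_rsqrt) (simp add: power2_eq_square)
          then show ?thesis by (simp add: field_simps)
        qed
        ultimately have "?b powr real (card W) * (2 / ?b powr 3 + 1 / ?b powr 4) \<le> ?b powr real (card W) * 1"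
          by (intro mult_left_mono) auto
        then show ?thesis by (simp add: powr_diff algebra_simps)
      qed
      finally show ?thesis .
    qed
  qed simp
qed

text \<open>A maximal independent set is determined by its trace on \<open>A\<close>: a vertex of
  \<open>B\<close> belongs to it exactly when it has no neighbour in that trace.\<close>

lemma card_mis_sets_bipartite:
  assumes "finite A" "finite B" and A: "\<And>x y. x \<in> A \<Longrightarrow> y \<in> A \<Longrightarrow> (x, y) \<notin> E"
    and B: "\<And>x y. x \<in> B \<Longrightarrow> y \<in> B \<Longrightarrow> (x, y) \<notin> E"
  shows "card (mis_sets E (A \<union> B)) \<le> 2 ^ card A"
proof -
  have "card (mis_sets E (A \<union> B)) \<le> card (Pow A)"
  proof (rule card_inj_on_le[of "\<lambda>I. I \<inter> A"])
    have "J \<subseteq> I" if IJ: "I \<in> mis_sets E (A \<union> B)" "J \<in> mis_sets E (A \<union> B)" "I \<inter> A = J \<inter> A" for I J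
    proof
      fix x assume x: "x \<in> J"
      show "x \<in> I"
      proof (rule ccontr)
        assume "x \<notin> I"
        then have xB: "x \<in> B" using x that by (auto simp: mis_sets_def)
        obtain u where u: "u \<in> I" "(x, u) \<in> E"
          using \<open>x \<notin> I\<close> xB IJ(1) unfolding mis_sets_def by blast
        then have "u \<in> A" using B[OF xB] IJ(1) by (auto simp: mis_sets_def)
        then have "u \<in> J" using u that(3) by blast
        then show False using u x that(2) by (auto simp: mis_sets_def)
      qed
    qed
    then show "inj_on (\<lambda>I. I \<inter> A) (mis_sets E (A \<union> B))"
      by (intro inj_onI) (metis subset_antisym)
  qed (use assms in auto)
  then show ?thesis using assms by (simp add: card_Pow)
qed

section \<open>Containers\<close>

text \<open>Weight each subset T by y^|T|. The total weight is (1 + y)^|V| \<le> 2^(\<eta>|V|/2),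
  while each counted T has weight at least 2^(-\<eta>|V|/2) once k is large compared with log(1/y).
  This bounds the number of fingerprints T.\<close>

lemma card_small_subsets:
  fixes \<eta> :: real
  assumes "0 < \<eta>"
  obtains k :: nat where "0 < k"
    "\<And>V :: 'a set. finite V \<Longrightarrow>
       real (card {T. T \<subseteq> V \<and> k * card T \<le> card V}) \<le> 2 powr (\<eta> * real (card V))"
proof -
  define x where "x = 2 powr (\<eta>/2) - 1"
  have x: "0 < x" "1 + x = 2 powr (\<eta>/2)" using assms by (simp_all add: x_def)
  define y where "y = min x 1"
  have y: "0 < y" "y \<le> 1" "1 + y \<le> 2 powr (\<eta>/2)" using x by (auto simp: y_def)
  \<comment> \<open>Chosen so that y \<ge> 2^(-k \<eta>/2); the added 1 keeps k positive.\<close>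
  define k where "k = nat \<lceil>log 2 (1/y) / (\<eta>/2)\<rceil> + 1"
  have "log 2 (1/y) / (\<eta>/2) \<le> real k" by (simp add: k_def) linarith
  then have k: "log 2 (1/y) \<le> real k * (\<eta>/2)"
    using assms by (simp add: field_simps)
  have k0: "0 < k" by (simp add: k_def)
  show ?thesis
  proof (rule that[OF k0])
    fix V :: "'a set" assume V: "finite V"
    let ?S = "{T. T \<subseteq> V \<and> k * card T \<le> card V}"
    \<comment> \<open>Lower bound for the weight of every counted set.\<close>
    define z where "z = 2 powr (- (\<eta>/2) * real (card V))"
    have fin: "finite ?S" using V by simp
    have "z \<le> y ^ card T" if "T \<in> ?S" for T
    proof -
      have "log 2 (1/y) * real (card T) \<le> real k * (\<eta>/2) * real (card T)"
        using k by (intro mult_right_mono) auto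
      also have "\<dots> = (\<eta>/2) * real (k * card T)" by simp
      also have "\<dots> \<le> (\<eta>/2) * real (card V)"
        using that assms by (intro mult_left_mono) (auto simp del: of_nat_mult)
      finally have "- (\<eta>/2) * real (card V) \<le> log 2 y * real (card T)"
        using y by (simp add: log_divide)
      then have "z \<le> 2 powr (log 2 y * real (card T))"
        unfolding z_def by (intro powr_mono) auto
      also have "\<dots> = y ^ card T"
        using y by (simp add: powr_realpow flip: powr_powr)
      finally show ?thesis .
    qed
    then have "real (card ?S) * z \<le> (\<Sum>T\<in>?S. y ^ card T)"
      by (intro sum_bounded_below) auto
    also have "\<dots> \<le> (\<Sum>T\<in>Pow V. y ^ card T)"
      using V y by (intro sum_mono2) auto
    \<comment> \<open>Expanding the product of the factors y + 1 over \<open>V\<close> yields one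
      term y^|T| for each subset T.\<close>
    also have "\<dots> = (1 + y) ^ card V"
      using prod_add[OF V, of "\<lambda>_. y" "\<lambda>_. 1"] by (simp add: add.commute)
    also have "\<dots> \<le> (2 powr (\<eta>/2)) ^ card V"
      using y by (intro power_mono) auto
    also have "\<dots> = 2 powr (\<eta> * real (card V)) * z"
      by (simp add: z_def powr_powr mult.commute flip: powr_realpow powr_add)
    finally show "real (card ?S) \<le> 2 powr (\<eta> * real (card V))"
      by (simp add: z_def)
  qed
qed

section \<open>Containers and the fingerprints that determine them\<close>

text \<open>The set depends on the fingerprint \<open>T\<close> alone and not on the independent set
  it came from, so there are no more containers than fingerprints.\<close>

definition container :: "'a rel \<Rightarrow> 'a set \<Rightarrow> nat \<Rightarrow> 'a set \<Rightarrow> 'a set" where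
  "container E V k T = {v \<in> V - E `` T. card (E `` {v} - E `` T) < k}"

text \<open>The empty set satisfies k|T| \<le> |N(T)|, so an inclusion-maximal such T in
  \<open>I\<close> exists, and k|T| \<le> |V| follows. A vertex of \<open>I\<close> with k
  neighbours outside N(T) could be added to T. Independence keeps \<open>I\<close> disjoint from
  N(T).\<close>

lemma mis_sets_in_container:
  assumes V: "finite V" "E \<subseteq> V \<times> V" and k: "0 < k" and I: "I \<in> mis_sets E V"
  obtains T where "T \<subseteq> V" "k * card T \<le> card V" "I \<in> mis_sets E (container E V k T)"
proof -
  have IV: "I \<subseteq> V" and ind: "\<And>u v. u \<in> I \<Longrightarrow> v \<in> I \<Longrightarrow> (u, v) \<notin> E"
    using I by (auto simp: mis_sets_def)
  have finI: "finite I" using IV V finite_subset by blast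
  have finE: "finite (E `` X)" for X
    using V by (meson finite_SigmaI finite_Image finite_subset)
  let ?P = "\<lambda>T. T \<subseteq> I \<and> k * card T \<le> card (E `` T)"
  have "finite (Collect ?P)" "Collect ?P \<noteq> {}" using finI by auto
  from finite_has_maximal[OF this] obtain T
    where "T \<in> Collect ?P" and max': "\<forall>S\<in>Collect ?P. T \<subseteq> S \<longrightarrow> T = S" ..
  then have T: "?P T" by simp
  have max: "T = S" if "?P S" "T \<subseteq> S" for S
    using max' that by simp
  have finT: "finite T" using T finI finite_subset by blast
  have "card (E `` {v} - E `` T) < k" if v: "v \<in> I" for v
  proof (rule ccontr)
    assume "\<not> ?thesis"
    then have c: "k \<le> card (E `` {v} - E `` T)" by simp
    \<comment> \<open>A vertex of \<open>T\<close> has no neighbours outside N(T), which contradicts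
      0 < k \<le> card of that set. So \<open>insert v T\<close> is a proper extension.\<close>
    have vT: "v \<notin> T"
    proof
      assume "v \<in> T"
      then have empty: "E `` {v} - E `` T = {}" by auto
      show False using c k unfolding empty by simp
    qed
    have "E `` insert v T = E `` T \<union> (E `` {v} - E `` T)" by auto
    then have "card (E `` insert v T) = card (E `` T) + card (E `` {v} - E `` T)"
      using card_Un_disjoint[of "E `` T" "E `` {v} - E `` T"] finE by (metis Diff_disjoint finite_Diff)
    then have "?P (insert v T)" using T c v vT finT by auto
    from max[OF this] show False using vT by blast
  qed
  then have "I \<subseteq> container E V k T"
    using IV ind T by (auto simp: container_def)
  then have "I \<in> mis_sets E (container E V k T)"
    using mis_sets_restrict[OF I] by (auto simp: container_def)
  moreover have "card (E `` T) \<le> card V" using V by (intro card_mono) auto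
  ultimately show ?thesis using that[of T] T IV by auto
qed

text \<open>Union bound over the fingerprints, with \<open>M\<close> a uniform bound for one
  container.\<close>

lemma card_mis_sets_containers:
  assumes V: "finite V" "E \<subseteq> V \<times> V" and k: "0 < k"
    and M: "\<And>T. T \<subseteq> V \<Longrightarrow> real (card (mis_sets E (container E V k T))) \<le> M"
  shows "real (card (mis_sets E V)) \<le> real (card {T. T \<subseteq> V \<and> k * card T \<le> card V}) * M"
proof -
  let ?S = "{T. T \<subseteq> V \<and> k * card T \<le> card V}"
  have fin: "finite ?S" using V by simp
  have finc: "finite (container E V k T)" for T using V by (simp add: container_def)
  have "mis_sets E V \<subseteq> (\<Union>T\<in>?S. mis_sets E (container E V k T))"
    using mis_sets_in_container[OF V k] by blast
  then have "card (mis_sets E V) \<le> card (\<Union>T\<in>?S. mis_sets E (container E V k T))"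
    using fin finc by (intro card_mono finite_UN_I) (auto simp: finite_mis_sets)
  also have "\<dots> \<le> (\<Sum>T\<in>?S. card (mis_sets E (container E V k T)))"
    using fin by (rule card_UN_le)
  finally have "real (card (mis_sets E V)) \<le> (\<Sum>T\<in>?S. real (card (mis_sets E (container E V k T))))"
    by (simp only: of_nat_sum[symmetric] of_nat_le_iff)
  also have "\<dots> \<le> real (card ?S) * M"
    using M by (intro sum_bounded_above) auto
  finally show ?thesis .
qed

section \<open>Counting edges between a container and N(T)\<close>

text \<open>The two sides bound the number of edges between \<open>P\<close> and \<open>Q\<close>
  from below and above. The real parameter \<open>a\<close> may be negative, which covers degree
  minus k when k exceeds the degree.\<close>

lemma double_counting:
  fixes a b :: real
  assumes "finite P" "finite Q" "sym E"
    and "\<And>p. p \<in> P \<Longrightarrow> a \<le> real (card (E `` {p} \<inter> Q))"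
    and "\<And>q. q \<in> Q \<Longrightarrow> real (card (E `` {q} \<inter> P)) \<le> b"
  shows "a * real (card P) \<le> b * real (card Q)"
proof -
  have eq: "(\<Sum>p\<in>P. card (E `` {p} \<inter> Q)) = (\<Sum>q\<in>Q. card (E `` {q} \<inter> P))"
  proof -
    have 1: "E `` {p} \<inter> Q = {q \<in> Q. (p, q) \<in> E}" for p by auto
    have 2: "E `` {q} \<inter> P = {p \<in> P. (p, q) \<in> E}" for q
      using assms(3) by (auto dest: symD)
    show ?thesis
      unfolding 1 2 using sum_multicount_gen[of P Q "\<lambda>p q. (p, q) \<in> E" "\<lambda>q. card {p \<in> P. (p, q) \<in> E}"] assms
      by simp
  qed
  have "a * real (card P) \<le> (\<Sum>p\<in>P. real (card (E `` {p} \<inter> Q)))"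
    using sum_bounded_below[of P a "\<lambda>p. real (card (E `` {p} \<inter> Q))"] assms(4) by (simp add: mult.commute)
  also have "\<dots> = (\<Sum>q\<in>Q. real (card (E `` {q} \<inter> P)))"
    using eq by (metis of_nat_sum)
  also have "\<dots> \<le> b * real (card Q)"
    using sum_bounded_above[of Q "\<lambda>q. real (card (E `` {q} \<inter> P))" b] assms(5) by (simp add: mult.commute)
  finally show ?thesis .
qed

lemma container_degree:
  assumes "finite V" "E \<subseteq> V \<times> V" "v \<in> container E V k T"
  shows "real (card (E `` {v})) - real k \<le> real (card (E `` {v} \<inter> E `` T))"
proof -
  have "finite (E `` {v})"
    using assms by (meson finite_SigmaI finite_Image finite_subset)
  then have "card (E `` {v}) = card (E `` {v} - E `` T) + card (E `` {v} \<inter> E `` T)"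
    by (metis Int_Diff_Un Int_Diff_disjoint add.commute card_Un_disjoint finite_Diff finite_Int)
  with assms(3) show ?thesis by (simp add: container_def)
qed

section \<open>Regular graphs\<close>

text \<open>Each vertex of the container W sends at least d - k edges into N(T), and each vertex of
  N(T) receives at most d. Since W and N(T) are disjoint, |N(T)| \<le> |V| - |W|.\<close>

lemma card_container_regular:
  assumes V: "finite V" "E \<subseteq> V \<times> V" "sym E" and deg: "\<And>v. v \<in> V \<Longrightarrow> card (E `` {v}) = d"
  shows "(2 * real d - real k) * real (card (container E V k T)) \<le> real d * real (card V)"
proof -
  let ?W = "container E V k T"
  have fin: "finite ?W" "finite (E `` T)" "finite (E `` {v})" for v
    using V by (auto simp: container_def intro: finite_subset[of _ V])
  have "(real d - real k) * real (card ?W) \<le> real d * real (card (E `` T))"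
  proof (rule double_counting[OF fin(1,2) V(3)])
    fix p assume p: "p \<in> ?W"
    then show "real d - real k \<le> real (card (E `` {p} \<inter> E `` T))"
      using container_degree[OF V(1,2) p] deg[of p] by (simp add: container_def)
  next
    fix q assume "q \<in> E `` T"
    then have "q \<in> V" using V by auto
    moreover have "card (E `` {q} \<inter> ?W) \<le> card (E `` {q})"
      using fin by (intro card_mono) auto
    ultimately show "real (card (E `` {q} \<inter> ?W)) \<le> real d"
      using deg by simp
  qed
  moreover have "card ?W + card (E `` T) \<le> card V"
  proof -
    have "card ?W + card (E `` T) = card (?W \<union> E `` T)"
      using fin by (intro card_Un_disjoint[symmetric]) (auto simp: container_def)
    also have "\<dots> \<le> card V"
      using V by (intro card_mono) (auto simp: container_def)
    finally show ?thesis .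
  qed
  then have "real d * (real (card ?W) + real (card (E `` T))) \<le> real d * real (card V)"
    by (intro mult_left_mono) auto
  ultimately show ?thesis by (simp add: algebra_simps)
qed

text \<open>Common core of both regular cases: an extremal bound 2^(c|W|) on induced subgraphs is
  applied to containers of size at most (1 + \<epsilon>/2) n/2, which halves the exponent up to a
  factor 1 + \<epsilon>.\<close>

lemma card_mis_sets_regular:
  fixes c \<epsilon> :: real
  assumes "0 < \<epsilon>" "1/2 \<le> c"
  obtains d\<^sub>0 :: nat where
    "\<And>d (V :: 'a set) E. d\<^sub>0 \<le> d \<Longrightarrow> finite V \<Longrightarrow> V \<noteq> {} \<Longrightarrow> E \<subseteq> V \<times> V \<Longrightarrow> sym E \<Longrightarrow>
       (\<And>v. v \<in> V \<Longrightarrow> card (E `` {v}) = d) \<Longrightarrow>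
       (\<And>W. W \<subseteq> V \<Longrightarrow> real (card (mis_sets E W)) \<le> 2 powr (c * real (card W))) \<Longrightarrow>
       real (card (mis_sets E V)) < 2 powr ((1 + \<epsilon>) * (c * real (card V) / 2))"
proof -
  \<comment> \<open>The containers leave slack c \<epsilon> n/4 in the exponent, which is at least
    \<epsilon> n/8 because c \<ge> 1/2. Choosing the fingerprint costs only half of that.\<close>
  have "0 < \<epsilon> / 16" using assms by simp
  then obtain k where k: "0 < k" and sub: "\<And>V :: 'a set. finite V \<Longrightarrow>
      real (card {T. T \<subseteq> V \<and> k * card T \<le> card V}) \<le> 2 powr (\<epsilon> / 16 * real (card V))"
    using card_small_subsets by blast
  \<comment> \<open>This gives \<epsilon> (d - k) \<ge> k, so that d / (2d - k) \<le> (1 +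
    \<epsilon>/2) / 2.\<close>
  define d\<^sub>0 where "d\<^sub>0 = nat \<lceil>real k / \<epsilon> + real k\<rceil>"
  show ?thesis
  proof (rule that[of d\<^sub>0])
    fix d :: nat and V :: "'a set" and E
    assume d: "d\<^sub>0 \<le> d" and V: "finite V" "V \<noteq> {}" "E \<subseteq> V \<times> V" "sym E"
      and deg: "\<And>v. v \<in> V \<Longrightarrow> card (E `` {v}) = d"
      and M: "\<And>W. W \<subseteq> V \<Longrightarrow> real (card (mis_sets E W)) \<le> 2 powr (c * real (card W))"
    define n where "n = real (card V)"
    have n: "0 < n" using V by (simp add: n_def card_gt_0_iff)
    have "real k / \<epsilon> + real k \<le> real d" using d by (simp add: d\<^sub>0_def)
    moreover have "0 \<le> real k / \<epsilon>" using assms by simp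
    ultimately have dk: "real k + \<epsilon> * real k \<le> \<epsilon> * real d" "real k \<le> real d"
      using assms by (simp add: field_simps, linarith)
    have cont: "real (card (container E V k T)) \<le> (1 + \<epsilon>/2) * n / 2" for T
    proof -
      let ?w = "real (card (container E V k T))"
      have pos: "0 < 2 * real d - real k" using dk k by linarith
      have "(2 * real d - real k) * ?w \<le> real d * n"
        unfolding n_def using V deg by (intro card_container_regular) auto
      also have "\<dots> \<le> (2 * real d - real k) * (1 + \<epsilon>/2) / 2 * n"
      proof (rule mult_right_mono)
        have "0 \<le> \<epsilon> * real k" using assms by simp
        with dk show "real d \<le> (2 * real d - real k) * (1 + \<epsilon>/2) / 2"
          by (simp add: algebra_simps)
      qed (use n in simp)
      finally have "(2 * real d - real k) * ?w \<le> (2 * real d - real k) * ((1 + \<epsilon>/2) * n / 2)"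
        by simp
      then show ?thesis using pos by (simp add: mult_le_cancel_left_pos)
    qed
    have "real (card (mis_sets E V)) \<le>
        real (card {T. T \<subseteq> V \<and> k * card T \<le> card V}) * 2 powr (c * ((1 + \<epsilon>/2) * n / 2))"
    proof (rule card_mis_sets_containers[OF V(1,3) k])
      fix T
      have "real (card (mis_sets E (container E V k T))) \<le> 2 powr (c * real (card (container E V k T)))"
        by (intro M) (auto simp: container_def)
      also have "\<dots> \<le> 2 powr (c * ((1 + \<epsilon>/2) * n / 2))"
        using cont assms by (intro powr_mono mult_left_mono) auto
      finally show "real (card (mis_sets E (container E V k T))) \<le> 2 powr (c * ((1 + \<epsilon>/2) * n / 2))" .
    qed
    also have "\<dots> \<le> 2 powr (\<epsilon> / 16 * n) * 2 powr (c * ((1 + \<epsilon>/2) * n / 2))"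
      unfolding n_def using sub[OF V(1)] by (intro mult_right_mono) auto
    also have "\<dots> = 2 powr (\<epsilon> / 16 * n + c * ((1 + \<epsilon>/2) * n / 2))"
      by (simp add: powr_add)
    also have "\<dots> < 2 powr ((1 + \<epsilon>) * (c * n / 2))"
    proof -
      have "1/2 * (\<epsilon> * n) \<le> c * (\<epsilon> * n)"
        using assms n by (intro mult_right_mono) auto
      moreover have "0 < \<epsilon> * n" using assms n by simp
      moreover have "c * ((1 + \<epsilon>/2) * n / 2) = c * n / 2 + c * (\<epsilon> * n) / 4"
        "(1 + \<epsilon>) * (c * n / 2) = c * n / 2 + c * (\<epsilon> * n) / 2"
        by (simp_all add: field_simps)
      ultimately have "\<epsilon> / 16 * n + c * ((1 + \<epsilon>/2) * n / 2) < (1 + \<epsilon>) * (c * n / 2)"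
        by linarith
      then show ?thesis by simp
    qed
    finally show "real (card (mis_sets E V)) < 2 powr ((1 + \<epsilon>) * (c * real (card V) / 2))"
      by (simp add: n_def)
  qed
qed

section \<open>Biregular graphs\<close>

text \<open>Both products count the edges between the parts; equality comes from double counting in
  each direction.\<close>

lemma card_biregular_parts:
  assumes "finite A" "finite B" "A \<inter> B = {}" "E \<subseteq> A \<times> B \<union> B \<times> A" "sym E"
    and r: "\<And>v. v \<in> A \<Longrightarrow> card (E `` {v}) = r" and s: "\<And>v. v \<in> B \<Longrightarrow> card (E `` {v}) = s"
  shows "r * card A = s * card B"
proof -
  have A: "E `` {v} \<inter> B = E `` {v}" if "v \<in> A" for v using assms(3,4) that by auto
  have B: "E `` {v} \<inter> A = E `` {v}" if "v \<in> B" for v using assms(3,4) that by auto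
  have "real r * real (card A) \<le> real s * real (card B)"
    using assms A B by (intro double_counting) auto
  moreover have "real s * real (card B) \<le> real r * real (card A)"
    using assms A B by (intro double_counting) auto
  ultimately have "real (r * card A) = real (s * card B)" by simp
  then show ?thesis by (simp only: of_nat_eq_iff)
qed

text \<open>Count edges between W \<inter> A and N(T) \<inter> B, and use that N(T) \<inter> B and W
  \<inter> B are disjoint subsets of \<open>B\<close>. Both parts of W appear on the left, so the
  inequality bounds the smaller one.\<close>

lemma card_container_biregular:
  fixes k :: nat and T :: "'a set"
  assumes fin: "finite A" "finite B" "A \<inter> B = {}" and E: "E \<subseteq> A \<times> B \<union> B \<times> A" "sym E"
    and r: "\<And>v. v \<in> A \<Longrightarrow> card (E `` {v}) = r" and s: "\<And>v. v \<in> B \<Longrightarrow> card (E `` {v}) = s"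
  defines W_def: "W \<equiv> container E (A \<union> B) k T"
  shows "(real r - real k) * real (card (W \<inter> A)) + real s * real (card (W \<inter> B)) \<le> real s * real (card B)"
proof -
  have E': "E \<subseteq> (A \<union> B) \<times> (A \<union> B)" using E by auto
  have WV: "W \<subseteq> A \<union> B - E `` T" by (auto simp: W_def container_def)
  have finE: "finite (E `` {v})" for v
    by (rule finite_subset[of _ "A \<union> B"]) (use fin E' in auto)
  have "(real r - real k) * real (card (W \<inter> A)) \<le> real s * real (card (E `` T \<inter> B))"
  proof (rule double_counting[OF _ _ E(2)])
    fix p assume p: "p \<in> W \<inter> A"
    then have "real (card (E `` {p})) - real k \<le> real (card (E `` {p} \<inter> E `` T))"
      using fin E' by (intro container_degree[of "A \<union> B"]) (auto simp: W_def)
    moreover have "E `` {p} \<inter> (E `` T \<inter> B) = E `` {p} \<inter> E `` T"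
      using p fin(3) E(1) by auto
    ultimately show "real r - real k \<le> real (card (E `` {p} \<inter> (E `` T \<inter> B)))"
      using r p by simp
  next
    fix q assume q: "q \<in> E `` T \<inter> B"
    have "card (E `` {q} \<inter> (W \<inter> A)) \<le> card (E `` {q})"
      using finE by (intro card_mono) auto
    then show "real (card (E `` {q} \<inter> (W \<inter> A))) \<le> real s"
      using s q by simp
  qed (use fin in auto)
  moreover have "card (E `` T \<inter> B) + card (W \<inter> B) \<le> card B"
  proof -
    have "card (E `` T \<inter> B) + card (W \<inter> B) = card (E `` T \<inter> B \<union> W \<inter> B)"
      using fin WV by (intro card_Un_disjoint[symmetric]) auto
    also have "\<dots> \<le> card B" using fin by (intro card_mono) auto
    finally show ?thesis .
  qed
  then have "real s * (real (card (E `` T \<inter> B)) + real (card (W \<inter> B))) \<le> real s * real (card B)"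
    by (intro mult_left_mono) auto
  ultimately show ?thesis by (simp add: algebra_simps)
qed

text \<open>Write L = rsn/(r+s)^2, so |A| = sn/(r+s) = L(r+s)/r. If s \<le> \<epsilon>r/2, the bound
  2^|A| is good enough. Otherwise L is at least \<epsilon>n/8, so the fingerprints cost little
  compared with L, and containers apply.\<close>

lemma card_mis_sets_biregular:
  fixes \<epsilon> :: real
  assumes \<epsilon>: "0 < \<epsilon>"
  obtains m\<^sub>0 :: nat where
    "\<And>r s (A :: 'a set) B E. 0 < s \<Longrightarrow> s \<le> r \<Longrightarrow> m\<^sub>0 \<le> r \<Longrightarrow> finite A \<Longrightarrow> finite B \<Longrightarrow> A \<union> B \<noteq> {} \<Longrightarrow>
       A \<inter> B = {} \<Longrightarrow> E \<subseteq> A \<times> B \<union> B \<times> A \<Longrightarrow> sym E \<Longrightarrow>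
       (\<And>v. v \<in> A \<Longrightarrow> card (E `` {v}) = r) \<Longrightarrow> (\<And>v. v \<in> B \<Longrightarrow> card (E `` {v}) = s) \<Longrightarrow>
       real (card (mis_sets E (A \<union> B))) <
         2 powr ((1 + \<epsilon>) * (real r * real s * real (card (A \<union> B)) / (real r + real s)\<^sup>2))"
proof -
  \<comment> \<open>Since L \<ge> \<epsilon> n/8 in the container case, the fingerprints cost at
    most \<epsilon> L/4, and the final exponent is at most (1 + 3\<epsilon>/4) L.\<close>
  have "0 < \<epsilon>\<^sup>2 / 32" using assms by simp
  then obtain k where k: "0 < k" and sub: "\<And>V :: 'a set. finite V \<Longrightarrow>
      real (card {T. T \<subseteq> V \<and> k * card T \<le> card V}) \<le> 2 powr (\<epsilon>\<^sup>2 / 32 * real (card V))"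
    using card_small_subsets by blast
  \<comment> \<open>This gives \<epsilon> (r - k) \<ge> 2k, so that r + s \<le> (1 + \<epsilon>/2)
    (r - k + s).\<close>
  define m\<^sub>0 where "m\<^sub>0 = nat \<lceil>2 * real k / \<epsilon> + real k\<rceil>"
  show ?thesis
  proof (rule that[of m\<^sub>0])
    fix r s :: nat and A B :: "'a set" and E
    assume rs: "0 < s" "s \<le> r" "m\<^sub>0 \<le> r"
      and fin: "finite A" "finite B" and ne: "A \<union> B \<noteq> {}" and disj: "A \<inter> B = {}"
      and E: "E \<subseteq> A \<times> B \<union> B \<times> A" "sym E"
      and deg: "\<And>v. v \<in> A \<Longrightarrow> card (E `` {v}) = r" "\<And>v. v \<in> B \<Longrightarrow> card (E `` {v}) = s"
    define n where "n = real (card (A \<union> B))"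
    define R S where "R = real r" and "S = real s"
    define L where "L = R * S * n / (R + S)\<^sup>2"
    have n: "0 < n" using ne fin by (simp add: n_def card_gt_0_iff)
    have RS: "0 < R" "0 < S" "S \<le> R" using rs by (simp_all add: R_def S_def)
    have L: "0 < L" using n RS by (simp add: L_def)
    have nAB: "n = real (card A) + real (card B)"
      using fin disj by (simp add: n_def card_Un_disjoint)
    have "R * real (card A) = S * real (card B)"
      using card_biregular_parts[OF fin disj E deg] by (metis R_def S_def of_nat_mult)
    then have A: "(R + S) * real (card A) = S * n" and B: "(R + S) * real (card B) = R * n"
      by (simp_all add: nAB algebra_simps)
    have LRS: "L * (R + S) = R * (S * n / (R + S))"
      using RS by (simp add: L_def power2_eq_square)
    \<comment> \<open>Stated for either order of the parts, so that the smaller part of a container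
      can serve as the exponent.\<close>
    have bip: "real (card (mis_sets E (A' \<union> B'))) \<le> 2 powr real (card A')"
      if "A' \<subseteq> A \<and> B' \<subseteq> B \<or> A' \<subseteq> B \<and> B' \<subseteq> A" for A' B'
    proof -
      have "card (mis_sets E (A' \<union> B')) \<le> 2 ^ card A'"
        using that E(1) disj fin by (intro card_mis_sets_bipartite) (auto intro: finite_subset)
      then have "real (card (mis_sets E (A' \<union> B'))) \<le> real (2 ^ card A')" by (simp only: of_nat_le_iff)
      then show ?thesis by (simp add: powr_realpow)
    qed
    have "real (card (mis_sets E (A \<union> B))) < 2 powr ((1 + \<epsilon>) * L)"
    proof (cases "S \<le> \<epsilon> / 2 * R")
      case True
      have "R * real (card A) = L * (R + S)"
        using A RS by (simp add: LRS field_simps)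
      also have "\<dots> \<le> L * (R + \<epsilon> / 2 * R)"
        using L True by (intro mult_left_mono) auto
      also have "\<dots> < R * ((1 + \<epsilon>) * L)"
        using L RS \<epsilon> by (simp add: algebra_simps)
      finally have "real (card A) < (1 + \<epsilon>) * L"
        using RS by (simp add: mult_less_cancel_left_pos)
      then have "2 powr real (card A) < 2 powr ((1 + \<epsilon>) * L)" by simp
      with bip[of A B] show ?thesis by (meson le_less_trans order_refl)
    next
      case False
      have "2 * real k / \<epsilon> + real k \<le> R" using rs by (simp add: m\<^sub>0_def R_def)
      moreover have "0 \<le> 2 * real k / \<epsilon>" using \<epsilon> by simp
      ultimately have kR: "2 * real k + \<epsilon> * real k \<le> \<epsilon> * R" "real k \<le> R"
        using \<epsilon> by (simp add: field_simps, linarith)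
      have cont: "real (card (mis_sets E (container E (A \<union> B) k T))) \<le> 2 powr ((1 + \<epsilon>/2) * L)" for T
      proof -
        let ?W = "container E (A \<union> B) k T"
        define w where "w = min (real (card (?W \<inter> A))) (real (card (?W \<inter> B)))"
        have W: "?W = ?W \<inter> A \<union> ?W \<inter> B" "?W = ?W \<inter> B \<union> ?W \<inter> A"
          by (auto simp: container_def)
        \<comment> \<open>Both coefficients R - k and S are nonnegative, so replacing each part of
          the container by the minimum \<open>w\<close> keeps the edge-counting inequality.\<close>
        have "(R - real k + S) * w = (R - real k) * w + S * w" by (simp add: algebra_simps)
        also have "\<dots> \<le> (R - real k) * real (card (?W \<inter> A)) + S * real (card (?W \<inter> B))"
          using kR RS by (intro add_mono mult_left_mono) (auto simp: w_def)
        also have "\<dots> \<le> S * real (card B)"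
          unfolding R_def S_def by (rule card_container_biregular[OF fin disj E deg])
        also have "\<dots> = L * (R + S)"
          using B RS by (simp add: LRS field_simps)
        also have "\<dots> \<le> L * ((1 + \<epsilon>/2) * (R - real k + S))"
        proof (rule mult_left_mono)
          have "0 \<le> \<epsilon> * S" using \<epsilon> RS by simp
          then show "R + S \<le> (1 + \<epsilon>/2) * (R - real k + S)"
            using kR by (simp add: algebra_simps)
        qed (use L in simp)
        finally have "(R - real k + S) * w \<le> (R - real k + S) * ((1 + \<epsilon>/2) * L)"
          by (simp add: mult_ac)
        then have "w \<le> (1 + \<epsilon>/2) * L"
          using kR RS by (simp add: mult_le_cancel_left_pos)
        moreover have "real (card (mis_sets E ?W)) \<le> 2 powr w"
          using bip[of "?W \<inter> A" "?W \<inter> B"] bip[of "?W \<inter> B" "?W \<inter> A"] W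
          by (auto simp: w_def min_def)
        moreover have "2 powr w \<le> 2 powr ((1 + \<epsilon>/2) * L)"
          using \<open>w \<le> (1 + \<epsilon>/2) * L\<close> by simp
        ultimately show ?thesis by linarith
      qed
      \<comment> \<open>Lower bound L \<ge> \<epsilon> n/8: here RS \<ge> \<epsilon> R^2/2, and (R +
        S)^2 \<le> 4 R^2 because S \<le> R.\<close>
      have "\<epsilon> / 2 * R * R \<le> S * R" using False RS by (intro mult_right_mono) auto
      moreover have "(R + S)\<^sup>2 \<le> (2 * R)\<^sup>2" using RS by (intro power_mono) auto
      then have "\<epsilon> / 8 * (R + S)\<^sup>2 \<le> \<epsilon> / 8 * (2 * R)\<^sup>2"
        using \<epsilon> by (intro mult_left_mono) auto
      ultimately have "\<epsilon> / 8 * (R + S)\<^sup>2 \<le> R * S"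
        by (simp add: power2_eq_square algebra_simps)
      then have "\<epsilon> / 8 \<le> R * S / (R + S)\<^sup>2" using RS by (simp add: field_simps)
      then have "\<epsilon> / 8 * n \<le> L"
        using mult_right_mono[of "\<epsilon> / 8" "R * S / (R + S)\<^sup>2" n] n by (simp add: L_def)
      then have "\<epsilon> / 4 * (\<epsilon> / 8 * n) \<le> \<epsilon> / 4 * L" using \<epsilon> by (intro mult_left_mono) auto
      then have \<eta>: "\<epsilon>\<^sup>2 / 32 * n \<le> \<epsilon> / 4 * L" by (simp add: power2_eq_square)
      have "real (card (mis_sets E (A \<union> B))) \<le>
          real (card {T. T \<subseteq> A \<union> B \<and> k * card T \<le> card (A \<union> B)}) * 2 powr ((1 + \<epsilon>/2) * L)"
        using fin E k cont by (intro card_mis_sets_containers) auto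
      also have "\<dots> \<le> 2 powr (\<epsilon>\<^sup>2 / 32 * n) * 2 powr ((1 + \<epsilon>/2) * L)"
        unfolding n_def using fin sub[of "A \<union> B"] by (intro mult_right_mono) auto
      also have "\<dots> = 2 powr (\<epsilon>\<^sup>2 / 32 * n + (1 + \<epsilon>/2) * L)"
        by (simp add: powr_add)
      also have "\<dots> < 2 powr ((1 + \<epsilon>) * L)"
      proof -
        have "0 < \<epsilon> * L" using \<epsilon> L by simp
        then have "\<epsilon>\<^sup>2 / 32 * n + (1 + \<epsilon>/2) * L < (1 + \<epsilon>) * L"
          using \<eta> by (simp add: algebra_simps)
        then show ?thesis by simp
      qed
      finally show ?thesis .
    qed
    then show "real (card (mis_sets E (A \<union> B))) <
        2 powr ((1 + \<epsilon>) * (real r * real s * real (card (A \<union> B)) / (real r + real s)\<^sup>2))"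
      by (simp only: L_def R_def S_def n_def)
  qed
qed

section \<open>Graphs as pair digraphs\<close>

context pair_graph
begin

lemma parcs_subset: "parcs G \<subseteq> pverts G \<times> pverts G"
  using in_arcsD1 in_arcsD2 by auto

lemma sym_parcs: "sym (parcs G)"
  by (auto intro: symI arcs_symmetric)

lemma irrefl_parcs: "irrefl (parcs G)"
  using no_loops' by (auto simp: irrefl_def)

lemma out_degree_eq_card_Image: "out_degree (with_proj G) v = card (parcs G `` {v})"
  by (simp add: out_degree_eq_card_neighbours Image_singleton)

lemma log_mis_less:
  assumes "real (card (mis_sets (parcs G) (pverts G))) < 2 powr x"
  shows "log 2 (real (mis G)) < x"
  using assms mis_pos by (simp add: log_less_iff mis_eq)

end

section \<open>The asymptotic bounds for log mis\<close>

text \<open>The core is used with c = 1/2 (Hujter-Tuza) and c = log 3 / 3 (Moon-Moser); the exponent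
  cn/2 becomes n/4 and n log 3 / 6.\<close>

lemma log_mis_regular:
  fixes \<epsilon> :: real
  assumes "0 < \<epsilon>"
  shows "\<exists>d\<^sub>0::nat. \<forall>d\<ge>d\<^sub>0. \<forall>G :: 'a pair_pre_digraph.
    pair_graph G \<and> pverts G \<noteq> {} \<and> regular_graph d G \<longrightarrow>
      (triangle_free G \<longrightarrow>
         log 2 (real (mis G)) < (1 + \<epsilon>) * (real (card (pverts G)) / 4)) \<and>
      log 2 (real (mis G)) < (1 + \<epsilon>) * (real (card (pverts G)) * log 2 3 / 6)"
proof -
  obtain d\<^sub>1 where d1: "\<And>d (V :: 'a set) E. d\<^sub>1 \<le> d \<Longrightarrow> finite V \<Longrightarrow> V \<noteq> {} \<Longrightarrow> E \<subseteq> V \<times> V \<Longrightarrow> sym E \<Longrightarrow>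
       (\<And>v. v \<in> V \<Longrightarrow> card (E `` {v}) = d) \<Longrightarrow>
       (\<And>W. W \<subseteq> V \<Longrightarrow> real (card (mis_sets E W)) \<le> 2 powr (1/2 * real (card W))) \<Longrightarrow>
       real (card (mis_sets E V)) < 2 powr ((1 + \<epsilon>) * (1/2 * real (card V) / 2))"
    using card_mis_sets_regular[OF assms order_refl] by blast
  \<comment> \<open>The core requires c \<ge> 1/2, that is 3 \<ge> 2^(3/2), which is 9 \<ge> 8 after
    squaring.\<close>
  have "log 2 (2 powr (3/2)) \<le> log 2 3"
  proof -
    have "(2 powr (3/2)) ^ 2 \<le> (3::real) ^ 2"
      by (simp add: powr_powr powr_numeral flip: powr_realpow)
    then have "2 powr (3/2) \<le> (3::real)" by (rule power2_le_imp_le) simp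
    then show ?thesis by (intro log_mono) auto
  qed
  then have log3: "1/2 \<le> log 2 3 / 3" by simp
  obtain d\<^sub>2 where d2: "\<And>d (V :: 'a set) E. d\<^sub>2 \<le> d \<Longrightarrow> finite V \<Longrightarrow> V \<noteq> {} \<Longrightarrow> E \<subseteq> V \<times> V \<Longrightarrow> sym E \<Longrightarrow>
       (\<And>v. v \<in> V \<Longrightarrow> card (E `` {v}) = d) \<Longrightarrow>
       (\<And>W. W \<subseteq> V \<Longrightarrow> real (card (mis_sets E W)) \<le> 2 powr (log 2 3 / 3 * real (card W))) \<Longrightarrow>
       real (card (mis_sets E V)) < 2 powr ((1 + \<epsilon>) * (log 2 3 / 3 * real (card V) / 2))"
    using card_mis_sets_regular[OF assms log3] by blast
  show ?thesis
  proof (intro exI[of _ "max d\<^sub>1 d\<^sub>2"] allI impI, elim conjE)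
    fix d :: nat and G :: "'a pair_pre_digraph"
    assume d: "max d\<^sub>1 d\<^sub>2 \<le> d" and "pair_graph G" and ne: "pverts G \<noteq> {}" and reg: "regular_graph d G"
    interpret pair_graph G by fact
    have deg: "card (parcs G `` {v}) = d" if "v \<in> pverts G" for v
      using reg that by (simp add: regular_graph_def out_degree_eq_card_Image)
    have finW: "finite W" if "W \<subseteq> pverts G" for W
      using that pair_finite_verts finite_subset by blast
    have "log 2 (real (mis G)) < (1 + \<epsilon>) * (1/2 * real (card (pverts G)) / 2)" if tf: "triangle_free G"
    proof (rule log_mis_less, rule d1[where d = d])
      fix W assume W: "W \<subseteq> pverts G"
      have "(z, x) \<notin> parcs G" if "(x, y) \<in> parcs G" "(y, z) \<in> parcs G" for x y z
        using tf that unfolding triangle_free_def by blast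
      from hujter_tuza[OF finW[OF W] sym_parcs irrefl_parcs this]
      show "real (card (mis_sets (parcs G) W)) \<le> 2 powr (1/2 * real (card W))"
        by (simp only: powr_powr)
    qed (use d ne parcs_subset sym_parcs deg pair_finite_verts in simp_all)
    moreover have "log 2 (real (mis G)) < (1 + \<epsilon>) * (log 2 3 / 3 * real (card (pverts G)) / 2)"
    proof (rule log_mis_less, rule d2[where d = d])
      fix W assume W: "W \<subseteq> pverts G"
      have "((3::real) powr (1/3)) powr real (card W) = (2 powr log 2 3) powr (1/3 * real (card W))"
        by (simp add: powr_powr)
      also have "\<dots> = 2 powr (log 2 3 / 3 * real (card W))"
        by (simp only: powr_powr) simp
      finally show "real (card (mis_sets (parcs G) W)) \<le> 2 powr (log 2 3 / 3 * real (card W))"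
        using moon_moser[OF finW[OF W] sym_parcs irrefl_parcs] by simp
    qed (use d ne parcs_subset sym_parcs deg pair_finite_verts in simp_all)
    ultimately show "(triangle_free G \<longrightarrow>
         log 2 (real (mis G)) < (1 + \<epsilon>) * (real (card (pverts G)) / 4)) \<and>
      log 2 (real (mis G)) < (1 + \<epsilon>) * (real (card (pverts G)) * log 2 3 / 6)"
      by (simp add: mult_ac)
  qed
qed

lemma log_mis_biregular:
  fixes \<epsilon> :: real
  assumes "0 < \<epsilon>"
  shows "\<exists>m\<^sub>0::nat. \<forall>r s :: nat. 0 < r \<and> 0 < s \<and> max r s \<ge> m\<^sub>0 \<longrightarrow>
    (\<forall>G :: 'a pair_pre_digraph.
       pair_graph G \<and> pverts G \<noteq> {} \<and> biregular_graph r s G \<longrightarrow>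
         log 2 (real (mis G)) <
           (1 + \<epsilon>) * (real r * real s * real (card (pverts G)) / (real r + real s)\<^sup>2))"
proof -
  obtain m\<^sub>0 where m0:
    "\<And>r s (A :: 'a set) B E. 0 < s \<Longrightarrow> s \<le> r \<Longrightarrow> m\<^sub>0 \<le> r \<Longrightarrow> finite A \<Longrightarrow> finite B \<Longrightarrow> A \<union> B \<noteq> {} \<Longrightarrow>
       A \<inter> B = {} \<Longrightarrow> E \<subseteq> A \<times> B \<union> B \<times> A \<Longrightarrow> sym E \<Longrightarrow>
       (\<And>v. v \<in> A \<Longrightarrow> card (E `` {v}) = r) \<Longrightarrow> (\<And>v. v \<in> B \<Longrightarrow> card (E `` {v}) = s) \<Longrightarrow>
       real (card (mis_sets E (A \<union> B))) <
         2 powr ((1 + \<epsilon>) * (real r * real s * real (card (A \<union> B)) / (real r + real s)\<^sup>2))"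
    using card_mis_sets_biregular[OF assms] by blast
  show ?thesis
  proof (intro exI[of _ m\<^sub>0] allI impI, elim conjE)
    fix r s :: nat and G :: "'a pair_pre_digraph"
    assume rs: "0 < r" "0 < s" "m\<^sub>0 \<le> max r s" and "pair_graph G" and ne: "pverts G \<noteq> {}"
      and "biregular_graph r s G"
    interpret pair_graph G by fact
    from \<open>biregular_graph r s G\<close> obtain A B where V: "pverts G = A \<union> B" and disj: "A \<inter> B = {}"
      and ind: "independent_set G A" "independent_set G B"
      and deg: "\<And>v. v \<in> A \<Longrightarrow> card (parcs G `` {v}) = r" "\<And>v. v \<in> B \<Longrightarrow> card (parcs G `` {v}) = s"
      by (auto simp: biregular_graph_def bipartition_def out_degree_eq_card_Image)
    have fin: "finite A" "finite B" using V pair_finite_verts by (metis finite_Un)+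
    have E: "parcs G \<subseteq> A \<times> B \<union> B \<times> A"
      using parcs_subset ind V by (auto simp: independent_set_def)
    show "log 2 (real (mis G)) <
        (1 + \<epsilon>) * (real r * real s * real (card (pverts G)) / (real r + real s)\<^sup>2)"
    proof (rule log_mis_less, cases "s \<le> r")
      case True
      then show "real (card (mis_sets (parcs G) (pverts G))) <
          2 powr ((1 + \<epsilon>) * (real r * real s * real (card (pverts G)) / (real r + real s)\<^sup>2))"
        using m0[of s r A B "parcs G"] rs fin ne disj E sym_parcs deg V by (simp add: max_def)
    next
      case False
      \<comment> \<open>The bound is symmetric in r and s, so exchanging the two parts reduces to
        the case where the first degree is the larger.\<close>
      then have "real (card (mis_sets (parcs G) (B \<union> A))) <
          2 powr ((1 + \<epsilon>) * (real s * real r * real (card (B \<union> A)) / (real s + real r)\<^sup>2))"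
        using rs fin ne disj E deg V by (intro m0 sym_parcs) auto
      then show "real (card (mis_sets (parcs G) (pverts G))) <
          2 powr ((1 + \<epsilon>) * (real r * real s * real (card (pverts G)) / (real r + real s)\<^sup>2))"
        by (simp add: V ac_simps Un_commute)
    qed
  qed
qed

text \<open>Graphs are taken nonempty because the inequalities are strict: the empty graph has
  exactly one maximal independent set, and both sides would be 0.\<close>

theorem theorem2:
  shows "(\<forall>\<epsilon>::real. \<epsilon> > 0 \<longrightarrow> (\<exists>d\<^sub>0::nat. \<forall>d\<ge>d\<^sub>0. \<forall>G :: 'a pair_pre_digraph.
            pair_graph G \<and> pverts G \<noteq> {} \<and> regular_graph d G \<longrightarrow>
              (triangle_free G \<longrightarrow>
                 log 2 (real (mis G)) < (1 + \<epsilon>) * (real (card (pverts G)) / 4)) \<and>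
              log 2 (real (mis G)) < (1 + \<epsilon>) * (real (card (pverts G)) * log 2 3 / 6)))
       \<and> (\<forall>\<epsilon>::real. \<epsilon> > 0 \<longrightarrow> (\<exists>m\<^sub>0::nat. \<forall>r s :: nat. 0 < r \<and> 0 < s \<and> max r s \<ge> m\<^sub>0 \<longrightarrow>
            (\<forall>G :: 'a pair_pre_digraph.
               pair_graph G \<and> pverts G \<noteq> {} \<and> biregular_graph r s G \<longrightarrow>
                 log 2 (real (mis G)) <
                   (1 + \<epsilon>) * (real r * real s * real (card (pverts G)) / (real r + real s)\<^sup>2))))"
  using log_mis_regular log_mis_biregular by blast

end
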